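(* For $n\ge 1$ let $D(n)$ be the conjunction of xor-clauses $$D(n)=(x_1\oplus x_{n+1}\oplus y)\wedge\bigwedge_{i=1}^n (x_i\oplus x_{i,a}\oplus x_{i,b})\wedge(x_{i,b}\oplus x_{i,c}\oplus x_{i+1})\wedge(x_i\oplus x_{i,d}\oplus x_{i,e})\wedge(x_{i,e}\oplus x_{i,f}\oplus x_{i+1}),$$ where $y$, $x_i$ ($1\le i\le n+1$) and $x_{i,a},\dots,x_{i,f}$ ($1\le i\le n$) are pairwise distinct variables. Then every EC-simulation formula $\psi$ for $D(n)$ with $\mathrm{vars}(\psi)=\mathrm{vars}(D(n))$ contains at least $2^n$ xor-clauses.
   Context: **Xor-clauses.** An xor-clause is an equation $z_1\oplus\dots\oplus z_k\equiv p$ over distinct propositional variables with $p\in\{\bot,\top\}$ ($\oplus$ is exclusive or); an xor-clause written $z_1\oplus\dots\oplus z_k$ means $z_1\oplus\dots\oplus z_k\equiv\top$. Equations are always simplified to normal form by cancelling repeated variables in pairs. The literal $x$ is identified with $(x\equiv\top)$ and $\neg x$ with $(x\equiv\bot)$. The unsatisfiable empty xor-clause is identified with $\bot$. $\mathrm{vars}(\phi)$ is the set of variables of $\phi$ and $\mathrm{lits}(\phi)=\{x,\neg x\mid x\in\mathrm{vars}(\phi)\}$. **UP.** $C[x/D]$ is the normal form of the xor-clause obtained from $C$ by replacing $x$ by $D$. Rules: from $(x\equiv\top)$ and an xor-clause $C$ infer $C[x/\top]$; from $(x\equiv\bot)$ and $C$ infer $C[x/\bot]$. **EC.** Rules (variables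 in one displayed xor-clause are distinct, $x_1,\dots,x_m$ pairwise distinct, $a,b,c_i,d\in\{\bot,\top\}$): from $(x\equiv\top),(x\equiv\bot)$ infer $\bot$; from $(x\equiv a),(x\oplus y\equiv b)$ infer $(y\equiv a\oplus b)$; from $(x\equiv a),(x\oplus y\oplus z\equiv b)$ infer $(y\oplus z\equiv a\oplus b)$; from $(x_1\oplus x_2\equiv c_1),\dots,(x_{m-1}\oplus x_m\equiv c_{m-1}),(x_1\oplus x_m\oplus y\equiv d)$ infer $(y\equiv c_1\oplus\dots\oplus c_{m-1}\oplus d)$; from $(x_1\oplus x_2\equiv c_1),\dots,(x_{m-1}\oplus x_m\equiv c_{m-1}),(x_m\oplus x_1\equiv c_m)$ with $c_1\oplus\dots\oplus c_m=\top$ infer $\bot$. (In these rules the letters are generic variables.) **Derivability.** For $S\in\{\mathrm{UP},\mathrm{EC}\}$, $D$ is $S$-derivable from $\psi$ if $D$ occurs in a finite sequence of xor-clauses each of which is in $\psi$ or is inferred from earlier ones by a rule of $S$. **EC-simulation formula.** A conjunction $\psi$ of xor-clauses is an EC-simulation formula for $\phi$ if (i) the satisfying truth assignments of $\phi$ are exactly those of $\phi\wedge\psi$ projected to $\mathrm{vars}(\phi)$, and (ii) for all $k\ge 0$, $\tilde l_1,\dots,\tilde l_k\in\mathrm{lits}(\phi)$ and every literal $\hat l$, if $\hat l$ is EC-derivable from $\phi\wedge\tilde l_1\wedge\dots\wedge\tilde l_k$, then $\hat l$ is UP-derivable from $(\phi\wedge\psi)\wedge\tilde l_1\wedge\dots\wedge\tilde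 l_k$. *)

theory Defs
  imports Main "HOL-Library.FSet" "HOL-Library.FuncSet"
begin

text \<open>
  An xor-clause in normal form is a finite set of variables together with a right-hand side, so
  \<open>XorClause {|z1, ..., zk|} p\<close> stands for \<open>z1 \<oplus> ... \<oplus> zk \<equiv> p\<close>. On \<^typ>\<open>bool\<close>, exclusive or is
  \<open>(\<noteq>)\<close>; the exclusive or of a finite family is the parity of the number of true members.
\<close>

datatype 'v xor_clause = XorClause (xvars: "'v fset") (rhs: bool)

definition xor_sum :: "('a \<Rightarrow> bool) \<Rightarrow> 'a set \<Rightarrow> bool" where
  "xor_sum f A \<longleftrightarrow> odd (card {i \<in> A. f i})"

definition lit :: "'v \<Rightarrow> bool \<Rightarrow> 'v xor_clause" where
  "lit x b = XorClause {|x|} b"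

definition false_clause :: "'v xor_clause" where
  "false_clause = XorClause {||} True"

text \<open>
  A conjunction of xor-clauses is represented by the (finite) set of its conjuncts.
\<close>

type_synonym 'v xor_formula = "'v xor_clause set"

definition vars :: "'v xor_formula \<Rightarrow> 'v set" where
  "vars \<phi> = (\<Union>C\<in>\<phi>. fset (xvars C))"

definition lits :: "'v xor_formula \<Rightarrow> 'v xor_clause set" where
  "lits \<phi> = {lit x b |x b. x \<in> vars \<phi>}"

definition satisfies :: "('v \<Rightarrow> bool) \<Rightarrow> 'v xor_clause \<Rightarrow> bool" where
  "satisfies \<tau> C \<longleftrightarrow> xor_sum \<tau> (fset (xvars C)) = rhs C"

text \<open>Truth assignments of a formula are functions with domain exactly its variables.\<close>

definition sat_assignments :: "'v xor_formula \<Rightarrow> ('v \<Rightarrow> bool) set" where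
  "sat_assignments \<phi> = {\<tau> \<in> vars \<phi> \<rightarrow>\<^sub>E UNIV. \<forall>C\<in>\<phi>. satisfies \<tau> C}"

definition subst_const :: "'v xor_clause \<Rightarrow> 'v \<Rightarrow> bool \<Rightarrow> 'v xor_clause" where
  "subst_const C x b =
    (if x |\<in>| xvars C then XorClause (xvars C |-| {|x|}) (rhs C \<noteq> b) else C)"

type_synonym 'v inference = "'v xor_clause set \<Rightarrow> 'v xor_clause \<Rightarrow> bool"

inductive UP :: "'v inference" where
  up_unit: "UP {lit x b, C} (subst_const C x b)"

text \<open>
  In the last two rules the premises force \<open>m \<ge> 2\<close>, since the variables of a displayed xor-clause
  are distinct; \<open>y\<close> may coincide with an inner variable \<open>x i\<close> where \<open>1 < i < m\<close>.
\<close>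

inductive EC :: "'v inference" where
  ec_conflict: "EC {lit x True, lit x False} false_clause"
| ec_unit2: "x \<noteq> y \<Longrightarrow> EC {lit x a, XorClause {|x, y|} b} (lit y (a \<noteq> b))"
| ec_unit3: "x \<noteq> y \<Longrightarrow> x \<noteq> z \<Longrightarrow> y \<noteq> z \<Longrightarrow>
    EC {lit x a, XorClause {|x, y, z|} b} (XorClause {|y, z|} (a \<noteq> b))"
| ec_path: "2 \<le> m \<Longrightarrow> inj_on x {1..m::nat} \<Longrightarrow> y \<noteq> x 1 \<Longrightarrow> y \<noteq> x m \<Longrightarrow>
    EC ({XorClause {|x i, x (i + 1)|} (c i) |i. 1 \<le> i \<and> i < m} \<union> {XorClause {|x 1, x m, y|} d})
       (lit y (xor_sum c {1..<m} \<noteq> d))"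
| ec_cycle: "2 \<le> m \<Longrightarrow> inj_on x {1..m::nat} \<Longrightarrow> xor_sum c {1..m} \<Longrightarrow>
    EC ({XorClause {|x i, x (i + 1)|} (c i) |i. 1 \<le> i \<and> i < m} \<union> {XorClause {|x m, x 1|} (c m)})
       false_clause"

definition derivation :: "'v inference \<Rightarrow> 'v xor_formula \<Rightarrow> 'v xor_clause list \<Rightarrow> bool" where
  "derivation S \<psi> Cs \<longleftrightarrow>
    (\<forall>i < length Cs. Cs ! i \<in> \<psi> \<or> (\<exists>P \<subseteq> set (take i Cs). S P (Cs ! i)))"

definition derivable :: "'v inference \<Rightarrow> 'v xor_formula \<Rightarrow> 'v xor_clause \<Rightarrow> bool" where
  "derivable S \<psi> C \<longleftrightarrow> (\<exists>Cs. derivation S \<psi> Cs \<and> C \<in> set Cs)"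

definition ec_simulation_formula :: "'v xor_formula \<Rightarrow> 'v xor_formula \<Rightarrow> bool" where
  "ec_simulation_formula \<phi> \<psi> \<longleftrightarrow>
    finite \<psi> \<and>
    sat_assignments \<phi> = (\<lambda>\<tau>. restrict \<tau> (vars \<phi>)) ` sat_assignments (\<phi> \<union> \<psi>) \<and>
    (\<forall>L x b. finite L \<and> L \<subseteq> lits \<phi> \<and> derivable EC (\<phi> \<union> L) (lit x b) \<longrightarrow>
       derivable UP ((\<phi> \<union> \<psi>) \<union> L) (lit x b))"

datatype D_var = Y | X nat | Xa nat | Xb nat | Xc nat | Xd nat | Xe nat | Xf nat

definition D :: "nat \<Rightarrow> D_var xor_formula" where
  "D n = {XorClause {|X 1, X (n + 1), Y|} True} \<union>
    (\<Union>i\<in>{1..n}.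
      {XorClause {|X i, Xa i, Xb i|} True,
       XorClause {|Xb i, Xc i, X (i + 1)|} True,
       XorClause {|X i, Xd i, Xe i|} True,
       XorClause {|Xe i, Xf i, X (i + 1)|} True})"

end

theory Submission imports Defs begin

text \<open>
  For each \<open>S \<subseteq> {1..n}\<close>, assume the literals \<open>x\<^sub>i\<^sub>,\<^sub>a, x\<^sub>i\<^sub>,\<^sub>c\<close> for \<open>i \<in> S\<close> and \<open>x\<^sub>i\<^sub>,\<^sub>d, x\<^sub>i\<^sub>,\<^sub>f\<close> for \<open>i \<notin> S\<close>.
  The rule for paths then derives \<open>y\<close>. Unit propagation can only leave the set \<open>V\<close> of assumed
  variables through a clause \<open>C\<close> of the conjunction having exactly one variable outside \<open>V\<close>. As \<open>C\<close>
  is a consequence of \<open>D n\<close>, it meets evenly every set of variables that meets every clause of \<open>D n\<close>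
  evenly; choosing suitable sets of this kind shows that the variables of \<open>C\<close> are exactly \<open>V\<close> and
  \<open>y\<close>. Hence \<open>C\<close> lies in \<open>\<psi>\<close>, and \<open>C\<close> determines \<open>S\<close>.
\<close>

section \<open>Derivations\<close>

lemma derivation_append:
  assumes "derivation R \<Phi> Cs" "derivation R \<Phi> Ds"
  shows "derivation R \<Phi> (Cs @ Ds)"
  unfolding derivation_def
proof (intro allI impI)
  fix i assume i: "i < length (Cs @ Ds)"
  show "(Cs @ Ds) ! i \<in> \<Phi> \<or> (\<exists>P\<subseteq>set (take i (Cs @ Ds)). R P ((Cs @ Ds) ! i))"
  proof (cases "i < length Cs")
    case True
    then show ?thesis using assms(1) by (auto simp: derivation_def nth_append)
  next
    case False
    then have "i - length Cs < length Ds" using i by auto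
    then have "Ds ! (i - length Cs) \<in> \<Phi> \<or>
        (\<exists>P\<subseteq>set (take (i - length Cs) Ds). R P (Ds ! (i - length Cs)))"
      using assms(2) by (auto simp: derivation_def)
    then show ?thesis using False by (auto simp: nth_append)
  qed
qed

lemma derivation_snoc:
  assumes "derivation R \<Phi> Cs" "C \<in> \<Phi> \<or> (\<exists>P\<subseteq>set Cs. R P C)"
  shows "derivation R \<Phi> (Cs @ [C])"
  using assms by (auto simp: derivation_def nth_append less_Suc_eq)

lemma derivable_axiom: "C \<in> \<Phi> \<Longrightarrow> derivable R \<Phi> C"
  unfolding derivable_def by (rule exI[of _ "[C]"]) (simp add: derivation_def)

lemma derivable_step:
  assumes "finite P" "\<And>C. C \<in> P \<Longrightarrow> derivable R \<Phi> C" "R P E"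
  shows "derivable R \<Phi> E"
proof -
  have "\<exists>Cs. derivation R \<Phi> Cs \<and> P \<subseteq> set Cs"
    using assms(1,2)
  proof (induction P)
    case empty
    show ?case by (rule exI[of _ "[]"]) (simp add: derivation_def)
  next
    case (insert C P)
    then obtain Cs Ds where "derivation R \<Phi> Cs" "P \<subseteq> set Cs" "derivation R \<Phi> Ds" "C \<in> set Ds"
      unfolding derivable_def by (metis insert_iff)
    then show ?case by (intro exI[of _ "Cs @ Ds"]) (auto intro: derivation_append)
  qed
  then obtain Cs where "derivation R \<Phi> Cs" "P \<subseteq> set Cs" by blast
  then show ?thesis
    unfolding derivable_def using assms(3)
    by (intro exI[of _ "Cs @ [E]"]) (auto intro: derivation_snoc)
qed

lemma derivable_induct [consumes 1, case_names base step]: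
  assumes "derivable R \<Phi> C"
    and base: "\<And>C. C \<in> \<Phi> \<Longrightarrow> Q C"
    and step: "\<And>P C. R P C \<Longrightarrow> (\<And>E. E \<in> P \<Longrightarrow> Q E) \<Longrightarrow> Q C"
  shows "Q C"
proof -
  obtain Cs where Cs: "derivation R \<Phi> Cs" "C \<in> set Cs"
    using assms(1) by (auto simp: derivable_def)
  have "Q (Cs ! i)" if "i < length Cs" for i
    using that
  proof (induction i rule: less_induct)
    case (less i)
    then consider "Cs ! i \<in> \<Phi>" | P where "P \<subseteq> set (take i Cs)" "R P (Cs ! i)"
      using Cs(1) by (auto simp: derivation_def)
    then show ?case
    proof cases
      case 1
      then show ?thesis by (rule base)
    next
      case 2
      have "Q E" if "E \<in> P" for E
        using that 2(1) less by (fastforce simp: in_set_conv_nth)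
      with 2(2) show ?thesis by (rule step)
    qed
  qed
  then show ?thesis using Cs(2) by (auto simp: in_set_conv_nth)
qed

text \<open>If no clause has exactly one variable outside \<open>V\<close>, unit propagation
  preserves this: a unit clause then has its variable in \<open>V\<close>, so substituting it leaves
  the variables outside \<open>V\<close> unchanged. A literal over \<open>x\<close> outside
  \<open>V\<close> would break the invariant.\<close>

lemma UP_derivable_literal_outside:
  assumes der: "derivable UP (\<Phi> \<union> L) (lit x b)" and "x \<notin> V"
    and L: "\<And>C. C \<in> L \<Longrightarrow> fset (xvars C) \<subseteq> V"
  obtains C z where "C \<in> \<Phi>" "fset (xvars C) - V = {z}"
proof (rule ccontr)
  assume "\<not> thesis"
  then have no: "\<And>C z. C \<in> \<Phi> \<Longrightarrow> fset (xvars C) - V \<noteq> {z}" using that by blast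
  have "\<forall>z. fset (xvars (lit x b)) - V \<noteq> {z}"
    using der
  proof (induction rule: derivable_induct)
    case (base C)
    then show ?case using no L by blast
  next
    case (step P C)
    from step.hyps show ?case
    proof cases
      case (up_unit u a E)
      then have "u \<in> V" and E: "\<forall>z. fset (xvars E) - V \<noteq> {z}"
        using step.IH[of "lit u a"] step.IH[of E] by (auto simp: lit_def)
      then have "fset (xvars C) - V = fset (xvars E) - V"
        using up_unit by (auto simp: subst_const_def)
      then show ?thesis using E by simp
    qed
  qed
  then show False using \<open>x \<notin> V\<close> by (simp add: lit_def insert_Diff_if)
qed

section \<open>Consequences of a formula\<close>

lemma satisfies_cong:
  assumes "\<And>v. v |\<in>| xvars C \<Longrightarrow> \<sigma> v = \<tau> v"
  shows "satisfies \<sigma> C = satisfies \<tau> C"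
proof -
  have "{v \<in> fset (xvars C). \<sigma> v} = {v \<in> fset (xvars C). \<tau> v}" using assms by auto
  then show ?thesis by (simp add: satisfies_def xor_sum_def)
qed

text \<open>Condition (i) extends each satisfying assignment of \<open>\<phi>\<close> to one of
  \<open>\<phi> \<union> \<psi>\<close>; as \<open>\<psi>\<close> has no further variables, the
  extension agrees with the original on every variable of \<open>C\<close>.\<close>

lemma ec_simulation_formula_consequence:
  assumes sim: "ec_simulation_formula \<phi> \<psi>" and vars: "vars \<psi> \<subseteq> vars \<phi>"
    and \<tau>: "\<And>E. E \<in> \<phi> \<Longrightarrow> satisfies \<tau> E" and C: "C \<in> \<phi> \<union> \<psi>"
  shows "satisfies \<tau> C"
proof -
  define \<sigma> where "\<sigma> = restrict \<tau> (vars \<phi>)"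
  have agree: "satisfies \<sigma> E = satisfies \<tau> E" if "fset (xvars E) \<subseteq> vars \<phi>" for E
    using that by (intro satisfies_cong) (auto simp: \<sigma>_def)
  have "satisfies \<sigma> E" if "E \<in> \<phi>" for E
    using agree[of E] \<tau>[OF that] that by (auto simp: vars_def)
  then have "\<sigma> \<in> sat_assignments \<phi>" by (auto simp: sat_assignments_def \<sigma>_def)
  then obtain \<rho> where \<rho>: "\<rho> \<in> sat_assignments (\<phi> \<union> \<psi>)" "\<sigma> = restrict \<rho> (vars \<phi>)"
    using sim by (auto simp: ec_simulation_formula_def)
  have CV: "fset (xvars C) \<subseteq> vars \<phi>" using C vars by (auto simp: vars_def)
  then have "satisfies \<rho> C = satisfies \<sigma> C"
    by (intro satisfies_cong) (auto simp: \<rho>(2))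
  moreover have "satisfies \<rho> C" using \<rho>(1) C by (auto simp: sat_assignments_def)
  ultimately show ?thesis using agree[OF CV] by simp
qed

text \<open>Both assignments give the same right-hand side, so the variables of \<open>C\<close> and
  those outside \<open>F\<close> have equal parity.\<close>

lemma even_card_if_satisfies_complement:
  assumes "satisfies (\<lambda>_. True) C" "satisfies (\<lambda>v. v \<notin> F) C"
  shows "even (card (fset (xvars C) \<inter> F))"
proof -
  let ?A = "fset (xvars C)"
  have "card ?A = card (?A - F) + card (?A \<inter> F)"
    by (metis card_Int_Diff finite_fset add.commute)
  moreover have "odd (card ?A) = odd (card (?A - F))"
    using assms by (simp add: satisfies_def xor_sum_def set_diff_eq)
  ultimately show ?thesis by (metis even_add)
qed

lemma satisfies_triple:
  assumes "p \<noteq> q" "p \<noteq> r" "q \<noteq> r"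
  shows "satisfies \<tau> (XorClause {|p, q, r|} b) \<longleftrightarrow> (\<tau> p \<noteq> (\<tau> q \<noteq> \<tau> r)) = b"
proof -
  have "{v. (v = p \<or> v = q \<or> v = r) \<and> \<tau> v} =
      (if \<tau> p then {p} else {}) \<union> (if \<tau> q then {q} else {}) \<union> (if \<tau> r then {r} else {})"
    by auto
  then show ?thesis using assms by (auto simp: satisfies_def xor_sum_def)
qed

section \<open>The formula \<open>D n\<close>\<close>

lemma satisfies_D_iff:
  assumes "1 \<le> n"
  shows "(\<forall>E\<in>D n. satisfies \<tau> E) \<longleftrightarrow>
    (\<tau> (X 1) \<noteq> (\<tau> (X (n + 1)) \<noteq> \<tau> Y)) \<and>
    (\<forall>i\<in>{1..n}. (\<tau> (X i) \<noteq> (\<tau> (Xa i) \<noteq> \<tau> (Xb i))) \<and>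
      (\<tau> (Xb i) \<noteq> (\<tau> (Xc i) \<noteq> \<tau> (X (i + 1)))) \<and>
      (\<tau> (X i) \<noteq> (\<tau> (Xd i) \<noteq> \<tau> (Xe i))) \<and>
      (\<tau> (Xe i) \<noteq> (\<tau> (Xf i) \<noteq> \<tau> (X (i + 1)))))"
  using assms unfolding D_def by (simp add: ball_Un satisfies_triple)

lemma vars_D:
  assumes "1 \<le> n"
  shows "vars (D n) =
    insert Y (X ` {1..n + 1}) \<union> (\<Union>i\<in>{1..n}. {Xa i, Xb i, Xc i, Xd i, Xe i, Xf i})"
proof -
  have "X (n + 1) \<in> vars (D n)" by (simp add: vars_def D_def)
  moreover have "X i \<in> vars (D n)" if "i \<in> {1..n}" for i
    using that by (force simp: vars_def D_def)
  ultimately have "X ` {1..n + 1} \<subseteq> vars (D n)" by (auto simp: le_Suc_eq)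
  moreover have "insert Y (\<Union>i\<in>{1..n}. {Xa i, Xb i, Xc i, Xd i, Xe i, Xf i}) \<subseteq> vars (D n)"
    by (force simp: vars_def D_def)
  moreover have "vars (D n) \<subseteq>
      insert Y (X ` {1..n + 1}) \<union> (\<Union>i\<in>{1..n}. {Xa i, Xb i, Xc i, Xd i, Xe i, Xf i})"
    using assms by (auto simp: vars_def D_def)
  ultimately show ?thesis by blast
qed

text \<open>\<open>S\<close> selects one of the two routes from \<open>X i\<close> to
  \<open>X (i + 1)\<close> for each \<open>i\<close>: via \<open>Xb i\<close> if
  \<open>i \<in> S\<close>, via \<open>Xe i\<close> otherwise. These are the edge variables along
  the selected routes.\<close>

definition path_vars :: "nat \<Rightarrow> nat set \<Rightarrow> D_var set" where
  "path_vars n S = (\<Union>i\<in>{1..n}. if i \<in> S then {Xa i, Xc i} else {Xd i, Xf i})"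

lemma mem_path_vars [simp]:
  "Y \<notin> path_vars n S" "X i \<notin> path_vars n S" "Xb i \<notin> path_vars n S" "Xe i \<notin> path_vars n S"
  "Xa i \<in> path_vars n S \<longleftrightarrow> i \<in> {1..n} \<and> i \<in> S"
  "Xc i \<in> path_vars n S \<longleftrightarrow> i \<in> {1..n} \<and> i \<in> S"
  "Xd i \<in> path_vars n S \<longleftrightarrow> i \<in> {1..n} \<and> i \<notin> S"
  "Xf i \<in> path_vars n S \<longleftrightarrow> i \<in> {1..n} \<and> i \<notin> S"
  by (auto simp: path_vars_def split: if_splits)

lemma finite_path_vars: "finite (path_vars n S)"
  by (simp add: path_vars_def)

lemma path_vars_subset_vars_D: "1 \<le> n \<Longrightarrow> path_vars n S \<subseteq> vars (D n)"
  by (auto simp: vars_D path_vars_def split: if_splits)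

text \<open>With its edge variable set to true, each clause on the selected route becomes an
  equality of two neighbours. The equalities link \<open>X 1\<close> to \<open>X (n + 1)\<close>,
  and \<open>ec_path\<close> applies with all labels \<open>False\<close>.\<close>

lemma EC_derivable_Y:
  assumes n: "1 \<le> n"
  shows "derivable EC (D n \<union> (\<lambda>v. lit v True) ` path_vars n S) (lit Y True)"
    (is "derivable EC ?\<Phi> _")
proof -
  have edge: "derivable EC ?\<Phi> (XorClause {|q, r|} False)"
    if "XorClause {|p, q, r|} True \<in> D n" "p \<in> path_vars n S" "p \<noteq> q" "p \<noteq> r" "q \<noteq> r" for p q r
  proof -
    have "EC {lit p True, XorClause {|p, q, r|} True} (XorClause {|q, r|} False)"
      using ec_unit3[of p q r True True] that by simp
    then show ?thesis
      by (rule derivable_step[rotated -1]) (use that in \<open>auto intro: derivable_axiom\<close>)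
  qed
  define mid where "mid i = (if i \<in> S then Xb i else Xe i)" for i
  \<comment> \<open>The path visits X 1, mid 1, X 2, ..., mid n, X (n + 1), numbered from 1, hence
    has \<open>2 * n + 1\<close> vertices.\<close>
  define z where "z k = (if odd k then X ((k + 1) div 2) else mid (k div 2))" for k
  have mid: "derivable EC ?\<Phi> (XorClause {|X i, mid i|} False)"
    "derivable EC ?\<Phi> (XorClause {|mid i, X (i + 1)|} False)" if i: "i \<in> {1..n}" for i
  proof -
    have cl: "XorClause {|Xa i, X i, Xb i|} True \<in> D n"
      "XorClause {|Xc i, Xb i, X (i + 1)|} True \<in> D n"
      "XorClause {|Xd i, X i, Xe i|} True \<in> D n"
      "XorClause {|Xf i, Xe i, X (i + 1)|} True \<in> D n"
      using i unfolding D_def finsert_commute[of "Xa i" "X i"] finsert_commute[of "Xc i" "Xb i"]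
        finsert_commute[of "Xd i" "X i"] finsert_commute[of "Xf i" "Xe i"] by blast+
    show "derivable EC ?\<Phi> (XorClause {|X i, mid i|} False)"
      using edge[OF cl(1)] edge[OF cl(3)] i by (auto simp: mid_def)
    show "derivable EC ?\<Phi> (XorClause {|mid i, X (i + 1)|} False)"
      using edge[OF cl(2)] edge[OF cl(4)] i by (auto simp: mid_def)
  qed
  let ?m = "2 * n + 1"
  let ?P = "{XorClause {|z k, z (k + 1)|} False |k. 1 \<le> k \<and> k < ?m} \<union>
    {XorClause {|z 1, z ?m, Y|} True}"
  have z_edge: "derivable EC ?\<Phi> (XorClause {|z k, z (k + 1)|} False)" if "1 \<le> k" "k < ?m" for k
  proof (cases "even k")
    case True
    then obtain i where "k = 2 * i" by blast
    then show ?thesis using mid(2)[of i] that by (simp add: z_def)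
  next
    case False
    then obtain i where "k = 2 * i + 1" by (blast elim: oddE)
    then show ?thesis using mid(1)[of "i + 1"] that by (simp add: z_def)
  qed
  have "inj_on z {1..?m}"
  proof (rule inj_on_inverseI)
    fix k assume "k \<in> {1..?m}"
    \<comment> \<open>A left inverse of \<open>z\<close>: the position is read off the
      variable.\<close>
    show "(case z k of X i \<Rightarrow> 2 * i - 1 | Xb i \<Rightarrow> 2 * i | Xe i \<Rightarrow> 2 * i) = k"
      by (cases "even k") (auto simp: z_def mid_def elim!: evenE oddE)
  qed
  moreover have "Y \<noteq> z 1" "Y \<noteq> z ?m" by (auto simp: z_def)
  ultimately have "EC ?P (lit Y True)"
    using ec_path[of ?m z Y "\<lambda>_. False" True] n by (simp add: xor_sum_def)
  moreover have "finite ?P"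
    by simp
  moreover have "derivable EC ?\<Phi> C" if "C \<in> ?P" for C
  proof -
    have "XorClause {|z 1, z ?m, Y|} True \<in> D n" by (simp add: z_def D_def)
    then show ?thesis using that z_edge by (auto intro: derivable_axiom)
  qed
  ultimately show ?thesis by (rule derivable_step[rotated -1])
qed

text \<open>
  Each \<open>F\<close> below is the set of variables flipped between two satisfying assignments of \<open>D n\<close>, the
  first of which makes every variable true.
\<close>

lemma xvars_of_consequence:
  assumes n: "1 \<le> n"
    and cons: "\<And>\<tau>. (\<forall>E\<in>D n. satisfies \<tau> E) \<Longrightarrow> satisfies \<tau> C"
    and CV: "fset (xvars C) \<subseteq> vars (D n)"
    and z: "fset (xvars C) - path_vars n S = {z}"
  shows "fset (xvars C) = insert Y (path_vars n S)"
proof -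
  let ?A = "fset (xvars C)" and ?V = "path_vars n S"
  have parity: "even (card (?A \<inter> F))" if "\<forall>E\<in>D n. satisfies (\<lambda>v. v \<notin> F) E" for F
    using cons[of "\<lambda>_. True"] cons[OF that] n
    by (intro even_card_if_satisfies_complement) (auto simp: satisfies_D_iff)
  \<comment> \<open>A flip set avoiding \<open>?V\<close> can meet \<open>?A\<close> only in
    \<open>z\<close>, and a single common element is odd.\<close>
  have away: "z \<notin> F" if "\<forall>E\<in>D n. satisfies (\<lambda>v. v \<notin> F) E" "F \<inter> ?V = {}" for F
  proof
    assume "z \<in> F"
    then have "?A \<inter> F = {z}" using z that(2) by blast
    then show False using parity[OF that(1)] by simp
  qed
  \<comment> \<open>Every clause of \<open>D n\<close> contains exactly two of these vertex
    variables.\<close>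
  define F0 where "F0 = range X \<union> range Xb \<union> range Xe"
  have "z \<notin> F0"
    by (rule away) (use n in \<open>auto simp: F0_def satisfies_D_iff\<close>)
  \<comment> \<open>Flipping the middle vertex of an unselected route together with its two edges
    preserves every clause and avoids \<open>?V\<close>.\<close>
  moreover have "z \<notin> {Xa i, Xb i, Xc i}" if "i \<notin> S" for i
    by (rule away) (use n that in \<open>auto simp: satisfies_D_iff\<close>)
  moreover have "z \<notin> {Xd i, Xe i, Xf i}" if "i \<in> S" for i
    by (rule away) (use n that in \<open>auto simp: satisfies_D_iff\<close>)
  moreover have "z \<in> vars (D n)" "z \<notin> ?V" using z CV by auto
  ultimately have Y: "z = Y"
    using n by (cases z) (auto simp: F0_def vars_D)
  have A: "?A \<subseteq> insert Y ?V" "Y \<in> ?A" using z Y by auto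
  have meet: "v \<in> ?A" if "\<forall>E\<in>D n. satisfies (\<lambda>v. v \<notin> F) E" "Y \<in> F" "F \<inter> ?V = {v}" for F v
  proof (rule ccontr)
    assume "v \<notin> ?A"
    then have "?A \<inter> F = {Y}" using A that(2,3) by auto
    then show False using parity[OF that(1)] by simp
  qed
  have ad: "v \<in> ?A" if i: "i \<in> {1..n}" and v: "v = (if i \<in> S then Xa i else Xd i)" for i v
  proof (rule meet)
    \<comment> \<open>A cut just after \<open>X i\<close>: all earlier vertices flip, hence also the
      two crossing edges, and \<open>Y\<close> because \<open>X 1\<close> flips but
      \<open>X (n + 1)\<close> does not. Exactly one crossing edge lies in
      \<open>?V\<close>.\<close>
    let ?F = "{Y, Xa i, Xd i} \<union> X ` {..i} \<union> Xb ` {..<i} \<union> Xe ` {..<i}"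
    show "\<forall>E\<in>D n. satisfies (\<lambda>v. v \<notin> ?F) E"
      using n i by (subst satisfies_D_iff) (auto simp: image_iff)
    show "?F \<inter> ?V = {v}" using i v by auto
  qed simp
  have cf: "v \<in> ?A" if i: "i \<in> {1..n}" and v: "v = (if i \<in> S then Xc i else Xf i)" for i v
  proof (rule meet)
    \<comment> \<open>The same cut moved just before \<open>X (i + 1)\<close>, so that
      \<open>Xc i\<close> and \<open>Xf i\<close> cross it.\<close>
    let ?F = "{Y, Xc i, Xf i} \<union> X ` {..i} \<union> Xb ` {..i} \<union> Xe ` {..i}"
    show "\<forall>E\<in>D n. satisfies (\<lambda>v. v \<notin> ?F) E"
      using n i by (subst satisfies_D_iff) (auto simp: image_iff)
    show "?F \<inter> ?V = {v}" using i v by auto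
  qed simp
  have "?V \<subseteq> ?A"
    unfolding path_vars_def
  proof (rule UN_least)
    fix i assume "i \<in> {1..n}"
    from ad[OF this refl] cf[OF this refl]
    show "(if i \<in> S then {Xa i, Xc i} else {Xd i, Xf i}) \<subseteq> ?A" by auto
  qed
  then show ?thesis using A by blast
qed

lemma clause_of_path:
  assumes n: "1 \<le> n" and sim: "ec_simulation_formula (D n) \<psi>" and vars: "vars \<psi> = vars (D n)"
  shows "\<exists>C\<in>\<psi>. fset (xvars C) = insert Y (path_vars n S)"
proof -
  let ?L = "(\<lambda>v. lit v True) ` path_vars n S"
  have "finite ?L" "?L \<subseteq> lits (D n)"
    using path_vars_subset_vars_D[OF n, of S] by (auto simp: finite_path_vars lits_def)
  then have "derivable UP (D n \<union> \<psi> \<union> ?L) (lit Y True)"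
    using sim EC_derivable_Y[OF n, of S] unfolding ec_simulation_formula_def by blast
  then obtain C z where C: "C \<in> D n \<union> \<psi>" "fset (xvars C) - path_vars n S = {z}"
    by (rule UP_derivable_literal_outside[where V = "path_vars n S"]) (auto simp: lit_def)
  have "fset (xvars C) \<subseteq> vars (D n \<union> \<psi>)" using C(1) by (auto simp: vars_def)
  also have "\<dots> = vars (D n)" using vars by (auto simp: vars_def)
  finally have eq: "fset (xvars C) = insert Y (path_vars n S)"
    using n C ec_simulation_formula_consequence[OF sim] vars
    by (intro xvars_of_consequence[of n C S z]) auto
  \<comment> \<open>Clauses of \<open>D n\<close> contain vertex variables, whereas \<open>C\<close>
    consists of \<open>Y\<close> and edge variables; so \<open>C\<close> must come from
    \<open>\<psi>\<close>.\<close>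
  have "\<exists>v\<in>fset (xvars E). \<exists>i. v = X i \<or> v = Xb i \<or> v = Xe i" if "E \<in> D n" for E
    using that by (auto simp: D_def)
  then have "C \<notin> D n" using eq by fastforce
  then show ?thesis using C(1) eq by blast
qed

theorem lemma2:
  fixes n :: nat and \<psi> :: "D_var xor_formula"
  assumes "1 \<le> n"
    and "ec_simulation_formula (D n) \<psi>"
    and "vars \<psi> = vars (D n)"
  shows "2 ^ n \<le> card \<psi>"
proof -
  obtain c where c: "\<And>S. c S \<in> \<psi>" "\<And>S. fset (xvars (c S)) = insert Y (path_vars n S)"
    using clause_of_path[OF assms] by metis
  have "inj_on c (Pow {1..n})"
  proof (rule inj_on_inverseI)
    fix S assume "S \<in> Pow {1..n}"
    \<comment> \<open>The variables \<open>Xa i\<close> alone recover \<open>S\<close> from its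
      clause.\<close>
    then show "{i. Xa i \<in> fset (xvars (c S))} = S" unfolding c(2) by auto
  qed
  moreover have "finite \<psi>" using assms(2) by (simp add: ec_simulation_formula_def)
  ultimately have "card (Pow {1..n}) \<le> card \<psi>" using c(1) by (intro card_inj_on_le) auto
  then show ?thesis by (simp add: card_Pow)
qed

end
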